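(* Let $G_p$ be an adaptively refined three-dimensional cartesian primal grid of the domain $\Omega\subset\mathbb{R}^3$ satisfying the 1-level transition constraint over faces and edges, and let $\mathcal{N}$ be the set of all nodes of $G_p$. Let $C_p$ be a cell of $G_p$, let $\mathcal{N}^+(C_p)=\mathcal{N}\cap C_p$ be the set of all grid nodes lying on the boundary of $C_p$ (its corners and all hanging nodes on its edges and faces), and let $N_i\in\mathcal{N}^+(C_p)$. Then $$C_p\cap V_{N_i}=C_p\cap\bigcap_{N_j\in\mathcal{N}^+(C_p),\,N_j\neq N_i}V_{N_i(N_j)},$$ where $V_{N_i}$ is the $L^\infty$-Voronoi region of $N_i$ with respect to the full node set $\mathcal{N}$ and $V_{N_i(N_j)}$ is the $L^\infty$-Voronoi region of $N_i$ with respect to the two nodes $N_i,N_j$ only.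
   Context: **Primal grid.** $\Omega\subset\mathbb{R}^3$ is a closed axis-parallel box. It is first subdivided into finitely many congruent closed axis-parallel cubes of a uniform cartesian lattice (the level-$0$ cells). The grid $G_p$ is obtained by finitely many regular refinements, each of which replaces one current cell of level $\ell$ by its eight congruent closed child cubes of half the side length, which have level $\ell+1$. The cells of $G_p$ are the closed cubes remaining at the end (the unrefined ones); they cover $\Omega$ and have pairwise disjoint interiors. **1-level transition constraint.** The levels of any two cells of $G_p$ that share (part of) a common face or (part of) a common edge, i.e. whose intersection contains a line segment of positive length, differ by at most $1$. No constraint is imposed on two cells whose intersection is a single point. **Nodes.** $\mathcal{N}$ is the set of all corners of all cells of $G_p$. For a cell $C_p$, $\mathcal{N}^+(C_p):=\mathcal{N}\cap C_p$. It contains the eight corners of $C_p$ and possibly hanging nodes at midpoints of edges and faces of $C_p$. **Voronoi regions.** All regions are taken with respect to the maximum norm $\|\cdot\|_\infty$. For two distinct nodes $N_i,N_j$, the region $V_{N_i(N_j)}\subset\Omega$ consists of the points that are at least as close to $N_i$ as to $N_j$. The boundary between $V_{N_i(N_j)}$ and $V_{N_j(N_i)}$ is called the separating surface. If the set of points equidistant from $N_i$ and $N_j$ has nonempty interior (this happens exactly when $N_i$ and $N_j$ have some equal coordinates), the separating surface is made unique by prolonging its uniquely determined part straight into the ambiguous region. Explicitly, with $T=T(N_i,N_j)\subseteq\{1,2,3\}$ the nonempty set of coordinate indices in which $N_i$ and $N_j$ differ, $$V_{N_i(N_j)}=\Big\{x\in\Omega:\ \max_{k\in T}|x_k-(N_i)_k|\le\max_{k\in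 T}|x_k-(N_j)_k|\Big\}.$$ When all coordinates of $N_i$ and $N_j$ differ, this is $\{x\in\Omega:\|x-N_i\|_\infty\le\|x-N_j\|_\infty\}$. The Voronoi region of $N_i$ with respect to all grid nodes is $$V_{N_i}=\bigcap_{N_j\in\mathcal{N},\,N_j\ne N_i}V_{N_i(N_j)}.$$ *)

theory Defs
  imports "HOL-Analysis.Analysis"
begin

text \<open>
  A cell is the pair of its lower corner and its level. The side length \<open>h\<close> of the level-0
  cells is an explicit parameter; a cell of level \<open>l\<close> has side length \<open>h / 2 ^ l\<close>.
\<close>

type_synonym cell = "(real^3) \<times> nat"

definition level :: "cell \<Rightarrow> nat" where
  "level c = snd c"

definition side :: "real \<Rightarrow> cell \<Rightarrow> real" where
  "side h c = h / 2 ^ level c"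

definition cube_corners :: "real^3 \<Rightarrow> real \<Rightarrow> (real^3) set" where
  "cube_corners p s = {x. \<forall>k. x $ k = p $ k \<or> x $ k = p $ k + s}"

definition cell_cube :: "real \<Rightarrow> cell \<Rightarrow> (real^3) set" where
  "cell_cube h c = cbox (fst c) (\<chi> k. fst c $ k + side h c)"

definition corners :: "real \<Rightarrow> cell \<Rightarrow> (real^3) set" where
  "corners h c = cube_corners (fst c) (side h c)"

text \<open>
  The lower corners of the eight children are the corners of the child that has the same
  lower corner as the parent.
\<close>

definition children :: "real \<Rightarrow> cell \<Rightarrow> cell set" where
  "children h c = {(q, Suc (level c)) | q. q \<in> cube_corners (fst c) (side h c / 2)}"

definition uniform_grid :: "(real^3) set \<Rightarrow> real \<Rightarrow> cell set \<Rightarrow> bool" where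
  "uniform_grid \<Omega> h G \<longleftrightarrow> h > 0 \<and>
     (\<exists>(a :: real^3) (n :: nat^3). (\<forall>k. n $ k > 0) \<and>
        \<Omega> = cbox a (\<chi> k. a $ k + h * real (n $ k)) \<and>
        G = {((\<chi> k. a $ k + h * real (m $ k)), 0) | m :: nat^3. \<forall>k. m $ k < n $ k})"

inductive primal_grid :: "(real^3) set \<Rightarrow> real \<Rightarrow> cell set \<Rightarrow> bool"
  for \<Omega> :: "(real^3) set" and h :: real where
  uniform: "uniform_grid \<Omega> h G \<Longrightarrow> primal_grid \<Omega> h G"
| refine: "primal_grid \<Omega> h G \<Longrightarrow> c \<in> G \<Longrightarrow> primal_grid \<Omega> h ((G - {c}) \<union> children h c)"

definition one_level_transition :: "real \<Rightarrow> cell set \<Rightarrow> bool" where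
  "one_level_transition h G \<longleftrightarrow>
     (\<forall>c\<in>G. \<forall>d\<in>G.
        (\<exists>x y. x \<noteq> y \<and> closed_segment x y \<subseteq> cell_cube h c \<inter> cell_cube h d) \<longrightarrow>
        \<bar>int (level c) - int (level d)\<bar> \<le> 1)"

definition nodes :: "real \<Rightarrow> cell set \<Rightarrow> (real^3) set" where
  "nodes h G = (\<Union>c\<in>G. corners h c)"

definition cell_nodes :: "real \<Rightarrow> cell set \<Rightarrow> cell \<Rightarrow> (real^3) set" where
  "cell_nodes h G c = nodes h G \<inter> cell_cube h c"

text \<open>
  The region of \<open>p\<close> with respect to \<open>p\<close> and \<open>q\<close> in the maximum norm. Only the coordinates in which
  \<open>p\<close> and \<open>q\<close> differ are compared: this prolongs the separating surface straight into the region
  where the set of equidistant points has nonempty interior. Meaningful only for \<open>p \<noteq> q\<close>, since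
  otherwise the maxima range over the empty set.
\<close>

definition pair_voronoi :: "(real^3) set \<Rightarrow> real^3 \<Rightarrow> real^3 \<Rightarrow> (real^3) set" where
  "pair_voronoi \<Omega> p q =
     {x \<in> \<Omega>. (MAX k\<in>{k. p $ k \<noteq> q $ k}. \<bar>x $ k - p $ k\<bar>)
            \<le> (MAX k\<in>{k. p $ k \<noteq> q $ k}. \<bar>x $ k - q $ k\<bar>)}"

definition voronoi :: "(real^3) set \<Rightarrow> (real^3) set \<Rightarrow> real^3 \<Rightarrow> (real^3) set" where
  "voronoi \<Omega> S p = (\<Inter>q\<in>S - {p}. pair_voronoi \<Omega> p q)"

lemma infnorm_eq_MAX: "infnorm (x :: real^3) = (MAX k. \<bar>x $ k\<bar>)"
  unfolding infnorm_cart
  by (subst cSup_eq_Max) (auto simp: full_SetCompr_eq)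

lemma pair_voronoi_infnorm:
  assumes "\<And>k. p $ k \<noteq> q $ k"
  shows "pair_voronoi \<Omega> p q = {x \<in> \<Omega>. infnorm (x - p) \<le> infnorm (x - q)}"
  using assms by (simp add: pair_voronoi_def infnorm_eq_MAX)

end

theory Submission imports Defs begin

text \<open>
  Let \<open>s\<close> be the side length of \<open>C\<close> and let \<open>x \<in> C\<close> lie in the region of \<open>p\<close> with respect to the
  nodes of \<open>C\<close>. Comparing \<open>p\<close> with the corner of \<open>C\<close> nearest to \<open>x\<close> shows that \<open>x\<close> has distance at
  most \<open>s / 2\<close> from \<open>p\<close>, so a node \<open>q\<close> at distance at least \<open>s / 2\<close> from \<open>C\<close> imposes no further
  condition. A node \<open>q \<notin> C\<close> at distance less than \<open>s / 2\<close> from \<open>C\<close> is not in the lattice of width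
  \<open>s / 2\<close>, hence belongs to a cell at least two levels finer than \<open>C\<close>. This cell lies in a cube
  \<open>Q\<close> of side \<open>s / 2\<close> that touches \<open>C\<close>. If \<open>Q\<close> shared a segment with \<open>C\<close>, the transition constraint
  would force \<open>Q\<close> to be contained in a single cell. Therefore \<open>Q\<close> touches \<open>C\<close> in a corner only, so
  this corner is the nearest point to \<open>q\<close> in \<open>C\<close>, and the condition imposed by \<open>q\<close> is implied by the
  one imposed by this corner.
\<close>

section \<open>Aligned cells\<close>

text \<open>Each cell lies on the lattice with origin \<open>a\<close> whose width is the cell's own
  side length. Overlap questions for cells of different levels thus become integer comparisons on
  the finer lattice.\<close>

definition aligned :: "real^3 \<Rightarrow> real \<Rightarrow> cell \<Rightarrow> bool" where
  "aligned a h c \<longleftrightarrow> (\<forall>k. \<exists>z::int. fst c $ k = a $ k + side h c * of_int z)"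

lemma side_pos: "h > 0 \<Longrightarrow> side h c > 0"
  by (simp add: side_def)

lemma side_Pair: "side h (q, n) = h / 2 ^ n"
  by (simp add: side_def level_def)

lemma mem_cell_cube:
  "x \<in> cell_cube h c \<longleftrightarrow> (\<forall>k. fst c $ k \<le> x $ k \<and> x $ k \<le> fst c $ k + side h c)"
  by (simp add: cell_cube_def mem_box_cart)

lemma mem_interior_cell_cube:
  "x \<in> interior (cell_cube h c) \<longleftrightarrow> (\<forall>k. fst c $ k < x $ k \<and> x $ k < fst c $ k + side h c)"
  by (simp add: cell_cube_def mem_box_cart interior_cbox)

lemma corners_subset_cell_cube:
  assumes "h > 0"
  shows "corners h c \<subseteq> cell_cube h c"
proof
  fix x assume "x \<in> corners h c"
  then have "x $ k = fst c $ k \<or> x $ k = fst c $ k + side h c" for k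
    by (simp add: corners_def cube_corners_def)
  then have "fst c $ k \<le> x $ k \<and> x $ k \<le> fst c $ k + side h c" for k
    using side_pos[OF assms, of c] by (smt (verit))
  then show "x \<in> cell_cube h c"
    by (simp add: mem_cell_cube)
qed

lemma cell_cube_eqD:
  assumes "h > 0" "cell_cube h c = cell_cube h d"
  shows "fst c = fst d"
proof -
  have "fst c \<in> cell_cube h c" "fst d \<in> cell_cube h d"
    using side_pos[OF assms(1)] by (simp_all add: mem_cell_cube less_imp_le)
  then have "fst c \<in> cell_cube h d" "fst d \<in> cell_cube h c"
    using assms(2) by blast+
  then show ?thesis
    by (simp add: mem_cell_cube vec_eq_iff order_antisym)
qed

text \<open>In units of the finer width the coarse endpoints are integers and the fine interval runs
  between consecutive integers, so no coarse endpoint can cut it. The common point may be an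
  endpoint of the coarse interval but not of the fine one.\<close>

lemma dyadic_interval_nested:
  fixes z w :: int
  assumes h: "h > (0::real)" and mn: "m \<le> n"
    and "h / 2 ^ m * z \<le> x" "x \<le> h / 2 ^ m * z + h / 2 ^ m"
    and "h / 2 ^ n * w < x" "x < h / 2 ^ n * w + h / 2 ^ n"
  shows "h / 2 ^ m * z \<le> h / 2 ^ n * w"
    and "h / 2 ^ n * w + h / 2 ^ n \<le> h / 2 ^ m * z + h / 2 ^ m"
proof -
  define \<delta> where "\<delta> = h / 2 ^ n"
  define K :: int where "K = 2 ^ (n - m)"
  have \<delta>: "\<delta> > 0" using h by (simp add: \<delta>_def)
  have "(2::real) ^ n = 2 ^ (n - m) * 2 ^ m"
    using mn by (simp flip: power_add)
  then have m: "h / 2 ^ m = \<delta> * K"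
    by (simp add: \<delta>_def K_def)
  have "\<delta> * of_int (K * z) < \<delta> * of_int (w + 1)"
    using assms(3,6) unfolding m \<delta>_def[symmetric] by (simp add: algebra_simps)
  then have 1: "K * z \<le> w"
    using \<delta> by (simp only: mult_less_cancel_left_pos of_int_less_iff)
  have "\<delta> * of_int w < \<delta> * of_int (K * z + K)"
    using assms(4,5) unfolding m \<delta>_def[symmetric] by (simp add: algebra_simps)
  then have 2: "w + 1 \<le> K * z + K"
    using \<delta> by (simp only: mult_less_cancel_left_pos of_int_less_iff)
  have "\<delta> * of_int (K * z) \<le> \<delta> * of_int w" "\<delta> * of_int (w + 1) \<le> \<delta> * of_int (K * z + K)"
    using 1 2 \<delta> by (simp_all only: mult_le_cancel_left_pos of_int_le_iff)
  then show "h / 2 ^ m * z \<le> h / 2 ^ n * w"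
    and "h / 2 ^ n * w + h / 2 ^ n \<le> h / 2 ^ m * z + h / 2 ^ m"
    unfolding m \<delta>_def[symmetric] by (simp_all add: algebra_simps)
qed

lemma aligned_nested:
  assumes h: "h > 0" and al: "aligned a h c" "aligned a h d" and lev: "level c \<le> level d"
    and x: "x \<in> cell_cube h c" "x \<in> interior (cell_cube h d)"
  shows "cell_cube h d \<subseteq> cell_cube h c"
proof -
  have "fst c $ k \<le> fst d $ k \<and> fst d $ k + side h d \<le> fst c $ k + side h c" for k
  proof -
    obtain z w :: int where zw: "fst c $ k = a $ k + side h c * z" "fst d $ k = a $ k + side h d * w"
      using al unfolding aligned_def by blast
    have xk: "fst c $ k \<le> x $ k" "x $ k \<le> fst c $ k + side h c"
      "fst d $ k < x $ k" "x $ k < fst d $ k + side h d"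
      using x by (simp_all add: mem_cell_cube mem_interior_cell_cube)
    show ?thesis
      using dyadic_interval_nested[OF h lev, of z "x $ k - a $ k" w] xk
      unfolding zw by (simp add: side_def)
  qed
  then show ?thesis
    by (fastforce simp: mem_cell_cube intro: order_trans)
qed

lemma aligned_same_level_eq:
  assumes "h > 0" "aligned a h c" "aligned a h d" "level c = level d"
    and "x \<in> interior (cell_cube h c)" "x \<in> interior (cell_cube h d)"
  shows "c = d"
proof -
  have "cell_cube h c = cell_cube h d"
    using aligned_nested[OF assms(1-3)] aligned_nested[OF assms(1,3,2)] assms(4-6) interior_subset
    by (metis order_refl subset_antisym subsetD)
  then have "fst c = fst d"
    by (rule cell_cube_eqD[OF assms(1)])
  with assms(4) show ?thesis
    by (simp add: level_def prod_eqI)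
qed

lemma center_in_interior:
  assumes "h > 0"
  shows "(\<chi> k. fst c $ k + side h c / 2) \<in> interior (cell_cube h c)"
  using side_pos[OF assms, of c] by (simp add: mem_interior_cell_cube)

text \<open>Rounding the center of the cell down to the lattice of level \<open>m\<close> gives a
  cube containing the center, and nestedness does the rest. This is pure arithmetic: the cube is not
  claimed to be a cell of the grid.\<close>

lemma aligned_ancestor:
  assumes h: "h > 0" and al: "aligned a h c" and m: "m \<le> level c"
  obtains q where "aligned a h (q, m)" "cell_cube h c \<subseteq> cell_cube h (q, m)"
proof -
  define x where "x = (\<chi> k. fst c $ k + side h c / 2)"
  define t where "t = h / 2 ^ m"
  define z where "z k = \<lfloor>(x $ k - a $ k) / t\<rfloor>" for k
  define q where "q = (\<chi> k. a $ k + t * z k)"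
  have t: "t > 0" using h by (simp add: t_def)
  have al': "aligned a h (q, m)"
    by (auto simp: aligned_def q_def side_Pair t_def)
  have "t * z k \<le> x $ k - a $ k \<and> x $ k - a $ k \<le> t * z k + t" for k
  proof -
    have "of_int (z k) \<le> (x $ k - a $ k) / t" "(x $ k - a $ k) / t < of_int (z k) + 1"
      unfolding z_def by linarith+
    then show ?thesis
      using t by (simp add: field_simps)
  qed
  then have "q $ k \<le> x $ k \<and> x $ k \<le> q $ k + t" for k
    unfolding q_def by (simp add: algebra_simps)
  then have "x \<in> cell_cube h (q, m)"
    by (simp add: mem_cell_cube side_Pair t_def)
  then have "cell_cube h c \<subseteq> cell_cube h (q, m)"
    using aligned_nested[OF h al' al] m center_in_interior[OF h, of c]
    by (simp add: level_def x_def)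
  with al' show ?thesis ..
qed

section \<open>Children of a cell\<close>

lemma level_children: "d \<in> children h c \<Longrightarrow> level d = Suc (level c)"
  by (auto simp: children_def level_def)

lemma side_children: "d \<in> children h c \<Longrightarrow> side h d = side h c / 2"
  by (auto simp: side_def level_children)

lemma aligned_children:
  assumes "aligned a h c" "d \<in> children h c"
  shows "aligned a h d"
  unfolding aligned_def
proof
  fix k
  obtain z :: int where z: "fst c $ k = a $ k + side h c * z"
    using assms(1) unfolding aligned_def by blast
  have "fst d $ k = fst c $ k \<or> fst d $ k = fst c $ k + side h c / 2"
    using assms(2) by (auto simp: children_def cube_corners_def)
  then have "fst d $ k = a $ k + side h d * of_int (2 * z) \<or>
      fst d $ k = a $ k + side h d * of_int (2 * z + 1)"
    using z by (auto simp: side_children[OF assms(2)] algebra_simps)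
  then show "\<exists>z::int. fst d $ k = a $ k + side h d * of_int z"
    by blast
qed

lemma children_subset_cell_cube:
  assumes "h > 0" "d \<in> children h c"
  shows "cell_cube h d \<subseteq> cell_cube h c"
proof
  fix x assume x: "x \<in> cell_cube h d"
  have "fst c $ k \<le> x $ k \<and> x $ k \<le> fst c $ k + side h c" for k
  proof -
    have "fst d $ k = fst c $ k \<or> fst d $ k = fst c $ k + side h c / 2"
      using assms(2) by (auto simp: children_def cube_corners_def)
    moreover have "fst d $ k \<le> x $ k" "x $ k \<le> fst d $ k + side h c / 2"
      using x by (simp_all add: mem_cell_cube side_children[OF assms(2)])
    ultimately show ?thesis
      using side_pos[OF assms(1), of c] by argo
  qed
  then show "x \<in> cell_cube h c"
    by (simp add: mem_cell_cube)
qed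

lemma children_cover:
  assumes "x \<in> cell_cube h c"
  shows "\<exists>d\<in>children h c. x \<in> cell_cube h d"
proof -
  define q where
    "q = (\<chi> k. if x $ k \<le> fst c $ k + side h c / 2 then fst c $ k else fst c $ k + side h c / 2)"
  have d: "(q, Suc (level c)) \<in> children h c"
    by (auto simp: children_def cube_corners_def q_def)
  have "x \<in> cell_cube h (q, Suc (level c))"
    unfolding mem_cell_cube side_children[OF d] using assms
    by (auto simp: mem_cell_cube q_def add.commute)
  with d show ?thesis by blast
qed

section \<open>Invariants of the refinement process\<close>

text \<open>This invariant replaces the refinement history. The level bound stands for finiteness
  and later supplies a lattice width that exceeds no cell's side.\<close>

definition subdivision :: "real^3 \<Rightarrow> (real^3) set \<Rightarrow> real \<Rightarrow> cell set \<Rightarrow> bool" where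
  "subdivision a \<Omega> h G \<longleftrightarrow>
     (\<forall>c\<in>G. aligned a h c) \<and> (\<Union>c\<in>G. cell_cube h c) = \<Omega> \<and>
     (\<forall>c\<in>G. \<forall>d\<in>G. c \<noteq> d \<longrightarrow> interior (cell_cube h c) \<inter> interior (cell_cube h d) = {}) \<and>
     (\<exists>L. \<forall>c\<in>G. level c \<le> L)"

lemma subdivisionD:
  assumes "subdivision a \<Omega> h G"
  shows "c \<in> G \<Longrightarrow> aligned a h c" and "(\<Union>c\<in>G. cell_cube h c) = \<Omega>"
    and "c \<in> G \<Longrightarrow> d \<in> G \<Longrightarrow> c \<noteq> d \<Longrightarrow>
      interior (cell_cube h c) \<inter> interior (cell_cube h d) = {}"
    and "\<exists>L. \<forall>c\<in>G. level c \<le> L"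
  using assms by (simp_all add: subdivision_def)

text \<open>The floor of \<open>y\<close> works except at the right end \<open>y = real n\<close>,
  which belongs to the last interval, with index \<open>n - 1\<close>.\<close>

lemma exists_unit_interval:
  fixes y :: real
  assumes "0 < n" "0 \<le> y" "y \<le> real n"
  shows "\<exists>m<n. real m \<le> y \<and> y \<le> real m + 1"
proof (cases "y = real n")
  case True
  then show ?thesis
    using assms by (intro exI[of _ "n - 1"]) auto
next
  case False
  then have "nat \<lfloor>y\<rfloor> < n" "real (nat \<lfloor>y\<rfloor>) \<le> y" "y \<le> real (nat \<lfloor>y\<rfloor>) + 1"
    using assms by linarith+
  then show ?thesis by blast
qed

lemma uniform_grid_subdivision:
  assumes "uniform_grid \<Omega> h G"
  shows "h > 0 \<and> (\<exists>a b. \<Omega> = cbox a b \<and> subdivision a \<Omega> h G)"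
proof -
  obtain a :: "real^3" and n :: "nat^3" where h: "h > 0" and n: "\<And>k. n $ k > 0"
    and \<Omega>: "\<Omega> = cbox a (\<chi> k. a $ k + h * real (n $ k))"
    and G: "G = {((\<chi> k. a $ k + h * real (m $ k)), 0) | m :: nat^3. \<forall>k. m $ k < n $ k}"
    using assms unfolding uniform_grid_def by blast
  have lev: "level c = 0" and side: "side h c = h" if "c \<in> G" for c
    using that by (auto simp: G level_def side_def)
  have al: "aligned a h c" if "c \<in> G" for c
    unfolding aligned_def side[OF that]
  proof
    fix k
    obtain m :: "nat^3" where "fst c = (\<chi> k. a $ k + h * real (m $ k))"
      using \<open>c \<in> G\<close> by (auto simp: G)
    then have "fst c $ k = a $ k + h * of_int (int (m $ k))" by simp
    then show "\<exists>z::int. fst c $ k = a $ k + h * of_int z" by blast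
  qed
  have "cell_cube h c \<subseteq> \<Omega>" if c: "c \<in> G" for c
  proof -
    obtain m :: "nat^3" where m: "fst c = (\<chi> k. a $ k + h * real (m $ k))" "\<And>k. m $ k < n $ k"
      using c by (auto simp: G)
    have "h * (real (m $ k) + 1) \<le> h * real (n $ k)" for k
      using m(2)[of k] h by (intro mult_left_mono) auto
    then have "a $ k \<le> fst c $ k \<and> fst c $ k + h \<le> a $ k + h * real (n $ k)" for k
      using h by (simp add: m(1) algebra_simps)
    then show ?thesis
      unfolding \<Omega> using side[OF c]
      by (fastforce simp: mem_cell_cube mem_box_cart intro: order_trans)
  qed
  moreover have "\<exists>c\<in>G. x \<in> cell_cube h c" if "x \<in> \<Omega>" for x
  proof -
    have "\<exists>m<n $ k. real m \<le> (x $ k - a $ k) / h \<and> (x $ k - a $ k) / h \<le> real m + 1" for k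
      using that h n[of k]
      by (intro exists_unit_interval) (auto simp: \<Omega> mem_box_cart field_simps)
    then obtain m where m: "\<And>k. m k < n $ k"
      "\<And>k. real (m k) \<le> (x $ k - a $ k) / h" "\<And>k. (x $ k - a $ k) / h \<le> real (m k) + 1"
      by metis
    define c :: cell where "c = ((\<chi> k. a $ k + h * real ((\<chi> k. m k) $ k)), 0)"
    have "c \<in> G"
      unfolding G c_def using m(1) by (intro CollectI exI[of _ "\<chi> k. m k"]) simp
    moreover have "x \<in> cell_cube h c"
      using m(2,3) h unfolding mem_cell_cube side[OF \<open>c \<in> G\<close>]
      by (simp add: c_def field_simps)
    ultimately show ?thesis by blast
  qed
  ultimately have "(\<Union>c\<in>G. cell_cube h c) = \<Omega>" by blast
  moreover have "interior (cell_cube h c) \<inter> interior (cell_cube h d) = {}"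
    if "c \<in> G" "d \<in> G" "c \<noteq> d" for c d
    using aligned_same_level_eq[OF h al[OF that(1)] al[OF that(2)]] lev that by auto
  ultimately have "subdivision a \<Omega> h G"
    unfolding subdivision_def using al lev by (metis order_refl)
  with h \<Omega> show ?thesis by blast
qed

text \<open>The children fill exactly the parent's cube, so covering and disjointness from the other
  cells are inherited. Siblings with a common interior point coincide because their levels
  agree.\<close>

lemma refine_subdivision:
  assumes h: "h > 0" and G: "subdivision a \<Omega> h G" and c: "c \<in> G"
  shows "subdivision a \<Omega> h (G - {c} \<union> children h c)"
proof -
  note al = subdivisionD(1)[OF G] and cov = subdivisionD(2)[OF G] and disj = subdivisionD(3)[OF G]
  obtain L where L: "\<And>d. d \<in> G \<Longrightarrow> level d \<le> L"
    using subdivisionD(4)[OF G] by blast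
  note al' = aligned_children[OF al[OF c]]
  have "(\<Union>d\<in>children h c. cell_cube h d) = cell_cube h c"
    using children_subset_cell_cube[OF h] children_cover by blast
  then have "(\<Union>d\<in>G - {c} \<union> children h c. cell_cube h d) = \<Omega>"
    using cov c by blast
  moreover have "interior (cell_cube h d) \<inter> interior (cell_cube h e) = {}"
    if "d \<in> G - {c} \<union> children h c" "e \<in> G - {c} \<union> children h c" "d \<noteq> e" for d e
  proof -
    note de = that
    have child: "interior (cell_cube h d) \<inter> interior (cell_cube h e) = {}"
      if "d \<in> children h c" "e \<in> G - {c}" for d e
      using interior_mono[OF children_subset_cell_cube[OF h that(1)]] disj[OF c, of e] that(2) by blast
    consider "d \<in> G" "e \<in> G" | "d \<in> children h c" "e \<in> G - {c}"
      | "e \<in> children h c" "d \<in> G - {c}" | "d \<in> children h c" "e \<in> children h c"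
      using de(1,2) by blast
    then show ?thesis
    proof cases
      case 1
      then show ?thesis using disj de(3) by blast
    next
      case 2
      then show ?thesis by (rule child)
    next
      case 3
      then show ?thesis using child[of e d] by blast
    next
      case 4
      then show ?thesis
        using aligned_same_level_eq[OF h al'[OF 4(1)] al'[OF 4(2)]] de(3) level_children by auto
    qed
  qed
  moreover have "level d \<le> Suc L" if "d \<in> G - {c} \<union> children h c" for d
    using that L[of d] L[OF c] level_children[of d h c] by auto
  moreover have "aligned a h d" if "d \<in> G - {c} \<union> children h c" for d
    using that al[of d] al'[of d] by blast
  ultimately show ?thesis
    unfolding subdivision_def by (intro conjI ballI impI exI[of _ "Suc L"]) simp_all
qed

lemma primal_grid_subdivision:
  assumes "primal_grid \<Omega> h G"
  shows "h > 0 \<and> (\<exists>a b. \<Omega> = cbox a b \<and> subdivision a \<Omega> h G)"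
  using assms
proof induction
  case (uniform G)
  then show ?case by (rule uniform_grid_subdivision)
next
  case (refine G c)
  then show ?case using refine_subdivision by blast
qed

section \<open>Nodes close to a cell\<close>

text \<open>Taken for all \<open>j\<close>, the conclusion says that clamping \<open>b\<close> to
  \<open>C\<close> yields a corner. Otherwise the cube of side \<open>side h C / 2\<close> around a
  fine cell at \<open>b\<close> would meet \<open>C\<close> in a segment of direction
  \<open>j\<close>, and the transition constraint forbids such fine cells there.\<close>

lemma node_near_cell_projects_to_corner:
  fixes b :: "real^3"
  assumes h: "h > 0" and \<Omega>: "\<Omega> = cbox \<alpha> \<beta>" and G: "subdivision a \<Omega> h G"
    and trans: "one_level_transition h G" and C: "C \<in> G" and b: "b \<in> nodes h G"
    and out: "b \<notin> cell_cube h C"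
    and near: "\<And>k. fst C $ k - side h C / 2 < b $ k"
      "\<And>k. b $ k < fst C $ k + side h C + side h C / 2"
  shows "\<not> (fst C $ j < b $ j \<and> b $ j < fst C $ j + side h C)"
proof
  assume bj: "fst C $ j < b $ j \<and> b $ j < fst C $ j + side h C"
  note al = subdivisionD(1)[OF G] and cov = subdivisionD(2)[OF G] and disj = subdivisionD(3)[OF G]
  obtain L0 where L0: "\<And>c. c \<in> G \<Longrightarrow> level c \<le> L0"
    using subdivisionD(4)[OF G] by blast
  define l where "l = level C"
  define t where "t = h / 2 ^ Suc l"
  have t: "t > 0" using h by (simp add: t_def)
  have sC: "side h C = 2 * t" by (simp add: side_def t_def l_def)
  note near' = near[unfolded sC]
  define p where "p = fst C"
  have p_al: "\<exists>w::int. p $ k = a $ k + t * w" for k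
  proof -
    obtain z :: int where "p $ k = a $ k + 2 * t * z"
      using al[OF C] unfolding aligned_def sC p_def by blast
    then have "p $ k = a $ k + t * of_int (2 * z)" by simp
    then show ?thesis by blast
  qed
  have memC: "x \<in> cell_cube h C \<longleftrightarrow> (\<forall>k. p $ k \<le> x $ k \<and> x $ k \<le> p $ k + 2 * t)" for x
    by (simp add: mem_cell_cube sC p_def)
  obtain E where E: "E \<in> G" "b \<in> corners h E"
    using b unfolding nodes_def by blast
  have bE: "b \<in> cell_cube h E"
    using E(2) corners_subset_cell_cube[OF h] by blast
  \<comment> \<open>If \<open>E\<close> were coarser, its side would be a multiple of
    \<open>t\<close> and \<open>b\<close> would lie on the lattice of width \<open>t\<close> through
    \<open>p\<close>. The strict bounds \<open>near\<close> leave only the offsets 0, 1, 2, all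
    within \<open>C\<close>, in a coordinate where \<open>b\<close> is outside
    \<open>C\<close>.\<close>
  have levE: "Suc l < level E"
  proof (rule ccontr)
    assume "\<not> Suc l < level E"
    then have le: "level E \<le> Suc l" by simp
    define K :: int where "K = 2 ^ (Suc l - level E)"
    have "(2::real) ^ Suc l = 2 ^ (Suc l - level E) * 2 ^ level E"
      using le by (simp only: power_add[symmetric]) simp
    then have sE: "side h E = t * K"
      by (simp add: side_def t_def K_def del: power_Suc)
    obtain k where k: "b $ k < p $ k \<or> p $ k + 2 * t < b $ k"
      using out unfolding memC by (meson not_le)
    obtain z w :: int where zw: "fst E $ k = a $ k + t * K * z" "p $ k = a $ k + t * w"
      using al[OF E(1)] p_al[of k] unfolding aligned_def sE by blast
    have "b $ k = fst E $ k \<or> b $ k = fst E $ k + t * K"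
      using E(2) by (simp add: corners_def cube_corners_def sE)
    then have "b $ k = p $ k + t * of_int (K * z - w) \<or> b $ k = p $ k + t * of_int (K * z + K - w)"
      unfolding zw by (auto simp: algebra_simps)
    then obtain v :: int where v: "b $ k = p $ k + t * v" by blast
    have "t * (-1) < t * of_int v" "t * of_int v < t * 3"
      using near'[of k] v unfolding p_def by linarith+
    then have "-1 < real_of_int v" "real_of_int v < 3"
      using t by (simp_all only: mult_less_cancel_left_pos)
    then have "v = 0 \<or> v = 1 \<or> v = 2" by linarith
    then show False
      using k v t by auto
  qed
  obtain u where Q: "aligned a h (u, Suc l)" "cell_cube h E \<subseteq> cell_cube h (u, Suc l)"
    using aligned_ancestor[OF h al[OF E(1)], of "Suc l"] levE by (metis less_imp_le)
  have "\<exists>z::int. u $ k = p $ k + t * z" for k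
  proof -
    obtain v w :: int where "u $ k = a $ k + t * v" "p $ k = a $ k + t * w"
      using Q(1) p_al[of k] unfolding aligned_def side_Pair t_def[symmetric] fst_conv by blast
    then have "u $ k = p $ k + t * of_int (v - w)" by (simp add: algebra_simps)
    then show ?thesis by blast
  qed
  then obtain z :: "3 \<Rightarrow> int" where z: "\<And>k. u $ k = p $ k + t * z k" by metis
  have memQ: "x \<in> cell_cube h (u, Suc l) \<longleftrightarrow> (\<forall>k. u $ k \<le> x $ k \<and> x $ k \<le> u $ k + t)" for x
    by (simp add: mem_cell_cube side_Pair t_def)
  have bQ: "u $ k \<le> b $ k" "b $ k \<le> u $ k + t" for k
    using bE Q(2) memQ by blast+
  \<comment> \<open>The values -1 and 2 mean that \<open>Q\<close>, the cube at \<open>u\<close>,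
    lies just below or just above the range of \<open>C\<close> in coordinate \<open>k\<close>; 0
    and 1 mean that it lies within this range.\<close>
  have zr: "z k = -1 \<or> z k = 0 \<or> z k = 1 \<or> z k = 2" for k
  proof -
    have "t * (-2) < t * of_int (z k)" "t * of_int (z k) < t * 3"
      using near'[of k] bQ[of k] z[of k] unfolding p_def by linarith+
    then have "-2 < real_of_int (z k)" "real_of_int (z k) < 3"
      using t by (simp_all only: mult_less_cancel_left_pos)
    then show ?thesis by linarith
  qed
  have zj: "z j = 0 \<or> z j = 1"
  proof -
    have "t * (-1) < t * of_int (z j)" "t * of_int (z j) < t * 2"
      using bj bQ[of j] z[of j] unfolding p_def sC by linarith+
    then have "-1 < real_of_int (z j)" "real_of_int (z j) < 2"
      using t by (simp_all only: mult_less_cancel_left_pos)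
    then show ?thesis by linarith
  qed
  \<comment> \<open>Being at least every level of \<open>G\<close> puts \<open>M\<close> inside any
    cell that contains its center; being at least \<open>Suc l\<close> makes \<open>t\<close> a
    multiple of \<delta>.\<close>
  define L where "L = max L0 (Suc l)"
  define \<delta> where "\<delta> = h / 2 ^ L"
  have \<delta>: "\<delta> > 0" using h by (simp add: \<delta>_def)
  have \<delta>t: "\<delta> \<le> t"
    using h unfolding \<delta>_def t_def by (intro frac_le power_increasing) (auto simp: L_def)
  have \<delta>E: "\<delta> \<le> side h E"
    using h L0[OF E(1)] unfolding \<delta>_def side_def
    by (intro frac_le power_increasing) (auto simp: L_def)
  \<comment> \<open>\<open>M\<close> is a cube in \<open>Q\<close> that touches \<open>C\<close> and is so small that it lies in a single cell \<open>F\<close>.\<close>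
  define m where "m = (\<chi> k. if z k = -1 then p $ k - \<delta> else u $ k)"
  define M where "M = (m, L)"
  have memM: "x \<in> cell_cube h M \<longleftrightarrow> (\<forall>k. m $ k \<le> x $ k \<and> x $ k \<le> m $ k + \<delta>)" for x
    by (simp add: mem_cell_cube side_Pair \<delta>_def M_def)
  define K :: int where "K = 2 ^ (L - Suc l)"
  have "(2::real) ^ L = 2 ^ (L - Suc l) * 2 ^ Suc l"
    by (simp only: power_add[symmetric]) (simp add: L_def)
  then have tK: "t = \<delta> * K"
    by (simp add: \<delta>_def t_def K_def del: power_Suc)
  have M_al: "aligned a h M"
    unfolding aligned_def
  proof
    fix k
    obtain w :: int where w: "p $ k = a $ k + \<delta> * K * w"
      using p_al[of k] unfolding tK by blast
    have "m $ k = a $ k + \<delta> * of_int (K * w - 1) \<or> m $ k = a $ k + \<delta> * of_int (K * w + K * z k)"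
      using w z[of k] unfolding m_def tK by (simp add: algebra_simps)
    then show "\<exists>v::int. fst M $ k = a $ k + side h M * of_int v"
      unfolding M_def side_Pair \<delta>_def[symmetric] fst_conv by blast
  qed
  define \<mu> where "\<mu> = (\<chi> k. m $ k + \<delta> / 2)"
  have \<mu>M: "\<mu> \<in> interior (cell_cube h M)"
    using center_in_interior[OF h, of M] by (simp add: \<mu>_def M_def side_Pair \<delta>_def)
  have \<mu>Q: "\<mu> \<in> interior (cell_cube h (u, Suc l))"
    unfolding mem_interior_cell_cube side_Pair t_def[symmetric] fst_conv
  proof
    fix k
    show "u $ k < \<mu> $ k \<and> \<mu> $ k < u $ k + t"
      using \<delta> \<delta>t z[of k] unfolding \<mu>_def m_def by auto
  qed
  have EQ: "u $ k \<le> fst E $ k \<and> fst E $ k + side h E \<le> u $ k + t" for k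
  proof -
    have "fst E \<in> cell_cube h E" "(\<chi> k. fst E $ k + side h E) \<in> cell_cube h E"
      using side_pos[OF h, of E] by (simp_all add: mem_cell_cube)
    then have "fst E \<in> cell_cube h (u, Suc l)" "(\<chi> k. fst E $ k + side h E) \<in> cell_cube h (u, Suc l)"
      using Q(2) by blast+
    then show ?thesis by (simp add: memQ)
  qed
  \<comment> \<open>Since \<Omega> is a box, membership can be checked coordinatewise. Where
    \<open>Q\<close> sticks out of \<open>C\<close>, the cell \<open>E\<close> provides the bound,
    being at least \<delta> wide; elsewhere \<open>C\<close> does.\<close>
  have hull: "\<alpha> $ k \<le> fst c $ k \<and> fst c $ k + side h c \<le> \<beta> $ k" if "c \<in> G" for c k
  proof -
    have "fst c \<in> cell_cube h c" "(\<chi> k. fst c $ k + side h c) \<in> cell_cube h c"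
      using side_pos[OF h, of c] by (simp_all add: mem_cell_cube)
    then have "fst c \<in> \<Omega>" "(\<chi> k. fst c $ k + side h c) \<in> \<Omega>"
      using cov that by blast+
    then show ?thesis by (simp add: \<Omega> mem_box_cart)
  qed
  \<comment> \<open>\<open>\<mu>\<close> lies in the smallest box that contains both \<open>C\<close> and \<open>E\<close>.\<close>
  have "\<mu> \<in> \<Omega>"
    unfolding \<Omega> mem_box_cart
  proof
    fix k
    show "\<alpha> $ k \<le> \<mu> $ k \<and> \<mu> $ k \<le> \<beta> $ k"
      using hull[OF C, of k] hull[OF E(1), of k] EQ[of k] zr[of k] z[of k] \<delta> \<delta>t \<delta>E t
      unfolding \<mu>_def m_def sC p_def[symmetric] by (auto simp: algebra_simps)
  qed
  then obtain F where F: "F \<in> G" "\<mu> \<in> cell_cube h F"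
    using cov by blast
  have MF: "cell_cube h M \<subseteq> cell_cube h F"
    using aligned_nested[OF h al[OF F(1)] M_al _ F(2) \<mu>M] L0[OF F(1)]
    by (simp add: M_def level_def L_def)
  \<comment> \<open>In each coordinate \<open>y\<close> takes an end of \<open>M\<close> that lies
    in \<open>C\<close>: the upper end where \<open>Q\<close> is below \<open>C\<close>, the lower
    end otherwise. Moving by \<delta> in direction \<open>j\<close> stays in both cubes because
    \<open>z j\<close> is 0 or 1.\<close>
  define y where "y = (\<chi> k. if z k = -1 then p $ k else u $ k)"
  define y' where "y' = (\<chi> k. if k = j then u $ k + \<delta> else y $ k)"
  have yM: "y \<in> cell_cube h M" "y' \<in> cell_cube h M"
    using \<delta> zj by (auto simp: memM y_def y'_def m_def)
  have ukC: "p $ k \<le> u $ k \<and> u $ k \<le> p $ k + 2 * t" if "z k \<noteq> -1" for k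
    using zr[of k] that t z[of k] by auto
  have yC: "y \<in> cell_cube h C" "y' \<in> cell_cube h C"
    using ukC zj z[of j] \<delta> \<delta>t t by (auto simp: memC y_def y'_def)
  have "y \<noteq> y'"
  proof
    assume "y = y'"
    then have "y $ j = y' $ j" by simp
    then show False using zj \<delta> by (auto simp: y_def y'_def)
  qed
  moreover have "closed_segment y y' \<subseteq> cell_cube h C \<inter> cell_cube h F"
    using yM yC MF by (intro closed_segment_subset) (auto simp: cell_cube_def convex_Int)
  ultimately have "\<bar>int (level C) - int (level F)\<bar> \<le> 1"
    using trans C F(1) unfolding one_level_transition_def by blast
  then have levF: "level F \<le> Suc l"
    by (simp add: l_def)
  \<comment> \<open>\<open>F\<close> is no finer than \<open>Q\<close> and contains the interior
    point \<mu> of \<open>Q\<close>, so it contains \<open>Q\<close> and with it \<open>E\<close>.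
    But \<open>E\<close> is strictly finer than \<open>F\<close>, contradicting disjoint
    interiors.\<close>
  have "cell_cube h (u, Suc l) \<subseteq> cell_cube h F"
    using aligned_nested[OF h al[OF F(1)] Q(1) _ F(2) \<mu>Q] levF by (simp add: level_def)
  then have "interior (cell_cube h E) \<subseteq> interior (cell_cube h F)"
    using Q(2) by (intro interior_mono) blast
  moreover have "E \<noteq> F"
    using levE levF by auto
  ultimately show False
    using disj[OF E(1) F(1)] center_in_interior[OF h, of E] by blast
qed

section \<open>Voronoi regions\<close>

lemma mem_pair_voronoi:
  assumes "p \<noteq> q"
  shows "x \<in> pair_voronoi \<Omega> p q \<longleftrightarrow> x \<in> \<Omega> \<and>
    (\<forall>k. p $ k \<noteq> q $ k \<longrightarrow> (\<exists>j. p $ j \<noteq> q $ j \<and> \<bar>x $ k - p $ k\<bar> \<le> \<bar>x $ j - q $ j\<bar>))"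
proof -
  have "{k. p $ k \<noteq> q $ k} \<noteq> {}"
    using assms by (auto simp: vec_eq_iff)
  then show ?thesis
    unfolding pair_voronoi_def by (subst Max_le_iff) (auto simp: Max_ge_iff)
qed

text \<open>The corner nearest to \<open>x\<close> is within half a side in every coordinate. A
  coordinate in which \<open>p\<close> is farther away must distinguish \<open>p\<close> from this
  corner, so it enters the comparison and refutes it.\<close>

lemma corners_voronoi_bound:
  assumes "x \<in> cell_cube h C"
    and vor: "\<And>c. c \<in> corners h C \<Longrightarrow> c \<noteq> p \<Longrightarrow> x \<in> pair_voronoi \<Omega> p c"
  shows "\<bar>x $ k - p $ k\<bar> \<le> side h C / 2"
proof (rule ccontr)
  assume far: "\<not> ?thesis"
  define c where
    "c = (\<chi> i. if x $ i \<le> fst C $ i + side h C / 2 then fst C $ i else fst C $ i + side h C)"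
  have c: "c \<in> corners h C"
    by (auto simp: corners_def cube_corners_def c_def)
  have near: "\<bar>x $ i - c $ i\<bar> \<le> side h C / 2" for i
  proof -
    have "fst C $ i \<le> x $ i \<and> x $ i \<le> fst C $ i + side h C"
      using assms(1) by (simp add: mem_cell_cube)
    then show ?thesis by (auto simp: c_def abs_if)
  qed
  have pc: "p $ k \<noteq> c $ k"
    using far near[of k] by auto
  then have "c \<noteq> p" by auto
  then obtain i where "\<bar>x $ k - p $ k\<bar> \<le> \<bar>x $ i - c $ i\<bar>"
    using vor[OF c] pc mem_pair_voronoi[of p c x \<Omega>] by blast
  then show False
    using far near[of i] by linarith
qed

text \<open>Clamping \<open>b\<close> to \<open>C\<close> brings it no farther from \<open>x\<close>
  in any coordinate, and every coordinate separating \<open>p\<close> from \<open>c\<close> also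
  separates \<open>p\<close> from \<open>b\<close>. The hypothesis on \<open>c\<close> is
  conditional because \<open>b\<close> may project onto \<open>p\<close> itself.\<close>

lemma pair_voronoi_if_projection:
  fixes h C b
  defines "c \<equiv> \<chi> k. max (fst C $ k) (min (b $ k) (fst C $ k + side h C))"
  assumes x: "x \<in> \<Omega>" "x \<in> cell_cube h C" and p: "p \<in> cell_cube h C"
    and pb: "p \<noteq> b" and vor: "c \<noteq> p \<Longrightarrow> x \<in> pair_voronoi \<Omega> p c"
  shows "x \<in> pair_voronoi \<Omega> p b"
proof -
  have bounds: "fst C $ k \<le> x $ k" "x $ k \<le> fst C $ k + side h C"
    "fst C $ k \<le> p $ k" "p $ k \<le> fst C $ k + side h C" for k
    using x(2) p by (simp_all add: mem_cell_cube)
  have cb: "\<bar>x $ k - c $ k\<bar> \<le> \<bar>x $ k - b $ k\<bar>" for k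
    using bounds[of k] by (auto simp: c_def max_def min_def)
  have pcb: "p $ k \<noteq> b $ k" if "p $ k \<noteq> c $ k" for k
    using that bounds[of k] by (auto simp: c_def)
  have "\<exists>i. p $ i \<noteq> b $ i \<and> \<bar>x $ k - p $ k\<bar> \<le> \<bar>x $ i - b $ i\<bar>" if "p $ k \<noteq> b $ k" for k
  proof (cases "p $ k = c $ k")
    \<comment> \<open>A coordinate compared for \<open>b\<close> but not for \<open>c\<close> is its
      own witness, since there \<open>p\<close> and \<open>c\<close> agree.\<close>
    case True
    then show ?thesis using that cb[of k] by (intro exI[of _ k]) simp
  next
    case False
    then have "c \<noteq> p" by auto
    then obtain i where "p $ i \<noteq> c $ i" "\<bar>x $ k - p $ k\<bar> \<le> \<bar>x $ i - c $ i\<bar>"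
      using vor False mem_pair_voronoi[of p c x \<Omega>] by blast
    then show ?thesis
      using pcb cb[of i] by (meson order_trans)
  qed
  with x(1) pb show ?thesis
    by (simp add: mem_pair_voronoi)
qed

section \<open>Reduction from all grid nodes to the nodes of one cell\<close>

theorem lemma1:
  fixes \<Omega> :: "(real^3) set" and h :: real and G :: "cell set" and C :: cell and N\<^sub>i :: "real^3"
  assumes "primal_grid \<Omega> h G"
    and "one_level_transition h G"
    and "C \<in> G"
    and "N\<^sub>i \<in> cell_nodes h G C"
  shows "cell_cube h C \<inter> voronoi \<Omega> (nodes h G) N\<^sub>i =
         cell_cube h C \<inter> (\<Inter>N\<^sub>j \<in> cell_nodes h G C - {N\<^sub>i}. pair_voronoi \<Omega> N\<^sub>i N\<^sub>j)"
proof
  show "cell_cube h C \<inter> voronoi \<Omega> (nodes h G) N\<^sub>i \<subseteq>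
      cell_cube h C \<inter> (\<Inter>N\<^sub>j \<in> cell_nodes h G C - {N\<^sub>i}. pair_voronoi \<Omega> N\<^sub>i N\<^sub>j)"
    by (auto simp: voronoi_def cell_nodes_def)
next
  obtain a \<alpha> \<beta> where h: "h > 0" and \<Omega>: "\<Omega> = cbox \<alpha> \<beta>" and G: "subdivision a \<Omega> h G"
    using primal_grid_subdivision[OF assms(1)] by blast
  have p: "N\<^sub>i \<in> cell_cube h C"
    using assms(4) by (simp add: cell_nodes_def)
  have corner: "corners h C \<subseteq> cell_nodes h G C"
    using assms(3) corners_subset_cell_cube[OF h, of C] by (auto simp: cell_nodes_def nodes_def)
  have "x \<in> pair_voronoi \<Omega> N\<^sub>i b"
    if x: "x \<in> cell_cube h C"
      and vor: "\<And>c. c \<in> cell_nodes h G C \<Longrightarrow> c \<noteq> N\<^sub>i \<Longrightarrow> x \<in> pair_voronoi \<Omega> N\<^sub>i c"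
      and b: "b \<in> nodes h G" "b \<noteq> N\<^sub>i" for x b
  proof (cases "b \<in> cell_cube h C")
    case True
    then show ?thesis
      using vor b by (simp add: cell_nodes_def)
  next
    case out: False
    have x\<Omega>: "x \<in> \<Omega>"
      using subdivisionD(2)[OF G] assms(3) x by blast
    have bounds: "fst C $ k \<le> x $ k" "x $ k \<le> fst C $ k + side h C"
      "fst C $ k \<le> N\<^sub>i $ k" "N\<^sub>i $ k \<le> fst C $ k + side h C" for k
      using x p by (simp_all add: mem_cell_cube)
    show ?thesis
    proof (cases "\<forall>k. fst C $ k - side h C / 2 < b $ k \<and> b $ k < fst C $ k + side h C + side h C / 2")
      case True
      have "\<not> (fst C $ j < b $ j \<and> b $ j < fst C $ j + side h C)" for j
        using node_near_cell_projects_to_corner[OF h \<Omega> G assms(2,3) b(1) out] True by blast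
      then have "(\<chi> k. max (fst C $ k) (min (b $ k) (fst C $ k + side h C))) \<in> corners h C"
        using side_pos[OF h, of C]
        by (auto simp: corners_def cube_corners_def max_def min_def not_less)
          (meson leI order_antisym)+
      then show ?thesis
        using pair_voronoi_if_projection[OF x\<Omega> x p b(2)[symmetric]] vor[OF subsetD[OF corner]]
        by blast
    next
      case False
      then obtain j where j: "b $ j \<le> fst C $ j - side h C / 2 \<or>
          fst C $ j + side h C + side h C / 2 \<le> b $ j"
        by (auto simp: not_less)
      \<comment> \<open>Coordinate \<open>j\<close> alone outweighs all distances from
        \<open>x\<close> to \<open>N\<^sub>i\<close>. Distance exactly half a side belongs to this
        case, as the near case needs strict bounds.\<close>
      have pj: "N\<^sub>i $ j \<noteq> b $ j"
        using j bounds[of j] side_pos[OF h, of C] by auto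
      have "\<bar>x $ k - N\<^sub>i $ k\<bar> \<le> \<bar>x $ j - b $ j\<bar>" for k
      proof -
        have "\<bar>x $ k - N\<^sub>i $ k\<bar> \<le> side h C / 2"
          using corners_voronoi_bound[OF x] vor corner by blast
        also have "\<dots> \<le> \<bar>x $ j - b $ j\<bar>"
          using j bounds[of j] by linarith
        finally show ?thesis .
      qed
      with pj x\<Omega> b(2) show ?thesis
        by (subst mem_pair_voronoi) auto
    qed
  qed
  then show "cell_cube h C \<inter> (\<Inter>N\<^sub>j \<in> cell_nodes h G C - {N\<^sub>i}. pair_voronoi \<Omega> N\<^sub>i N\<^sub>j) \<subseteq>
      cell_cube h C \<inter> voronoi \<Omega> (nodes h G) N\<^sub>i"
    by (auto simp: voronoi_def)
qed

end
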